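(* For $i=1,2,3,4$ let $a_i,e_i$ be nonzero real numbers, $b_i=c_i=0$, and $f_i\in(-1,1]$, such that $(a_i,b_i,c_i,e_i)$ satisfies the standing inequalities of the context, and let $M=(G^{(1)},G^{(2)},G^{(3)},G^{(4)})\subset\mathbb{C}[x_1,x_2,x_3,x_4]$ be the associated ideal. For each $i$ set $$k_i=\frac{-1\pm\sqrt{1-4a_ie_i}}{2a_i},\qquad N_i=\begin{pmatrix}-2f_i & k_i(1-f_i^2)\\ 1-f_i^2 & 2k_if_i\end{pmatrix},$$ where the sign in $k_i$ may be chosen independently for each $i$. Then $M$ is a matching, i.e. the zero set $Z(M)\subset(\mathbb{C}P^1)^4$ is infinite, if and only if there exists a choice of the four signs for which $N_4N_3N_2N_1$ is a scalar matrix.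
   Context: Indices are taken modulo 4 (so $x_5=x_1$). For each $i\in\{1,2,3,4\}$ one has real coefficients $a_i,b_i,c_i,e_i$ and $f_i\in(-1,1]$, with the standing inequalities $$(1-4a_ie_i-4b_ic_i)^2>64a_ib_ic_ie_i,\qquad |b_i+c_i-a_i-e_i|<1.$$ Define $g^{(i)}(x_i,y_i)=a_ix_i^2y_i^2+b_ix_i^2+c_iy_i^2+x_iy_i+e_i$, $h^{(i)}(y_i,x_{i+1})=(1-f_i^2)(y_i-x_{i+1})-2f_i(y_ix_{i+1}+1)$, and $$G^{(i)}(x_i,x_{i+1})=\mathrm{Res}(g^{(i)},h^{(i)};y_i)=(1-f_i^2-2f_ix_{i+1})^2\,g^{(i)}\!\left(x_i,\tfrac{(1-f_i^2)x_{i+1}+2f_i}{1-f_i^2-2f_ix_{i+1}}\right),$$ a polynomial of degree at most 2 in each variable. The zero set $Z(M)\subset(\mathbb{C}P^1)^4$ of the ideal $M=(G^{(1)},G^{(2)},G^{(3)},G^{(4)})$ is the set of points $(x_1,x_2,x_3,x_4)$ at which all $G^{(i)}$ vanish, where zeros with some coordinate equal to $\infty$ are understood by homogenizing $G^{(i)}$ to bidegree $(2,2)$ in $(x_i,x_{i+1})$. $M$ is called a matching if $Z(M)$ is an infinite set (this encodes flexibility of the associated $3\times3$ quadrilateral mesh). *)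

theory Defs
  imports
    Complex_Main
    "HOL-Library.Numeral_Type"
    "Subresultants.Resultant_Prelim"
begin

text \<open>
  Indices range over the numeral type \<open>4\<close>, whose arithmetic is modulo 4; in particular
  \<open>4 = 0\<close> and \<open>4 + 1 = 1\<close>.
\<close>

definition standing_ineqs :: "real \<Rightarrow> real \<Rightarrow> real \<Rightarrow> real \<Rightarrow> bool" where
  "standing_ineqs a b c e \<longleftrightarrow>
     (1 - 4*a*e - 4*b*c)\<^sup>2 > 64*a*b*c*e \<and> \<bar>b + c - a - e\<bar> < 1"

definition g_form :: "'a::comm_ring_1 \<Rightarrow> 'a \<Rightarrow> 'a \<Rightarrow> 'a \<Rightarrow> 'a \<Rightarrow> 'a \<Rightarrow> 'a" where
  "g_form a b c e x y = a * x^2 * y^2 + b * x^2 + c * y^2 + x * y + e"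

definition h_form :: "'a::comm_ring_1 \<Rightarrow> 'a \<Rightarrow> 'a \<Rightarrow> 'a" where
  "h_form f y x' = (1 - f^2) * (y - x') - 2 * f * (y * x' + 1)"

text \<open>
  The ring \<open>\<complex>[x\<^sub>i][x\<^sub>i\<^sub>+\<^sub>1][y\<^sub>i]\<close>: the outermost variable is \<open>y\<^sub>i\<close>, the innermost one \<open>x\<^sub>i\<close>.
\<close>

definition const3 :: "real \<Rightarrow> complex poly poly poly" where
  "const3 r = [:[:[:complex_of_real r:]:]:]"

definition var_x :: "complex poly poly poly" where "var_x = [:[:[:0, 1:]:]:]"
definition var_x' :: "complex poly poly poly" where "var_x' = [:[:0, 1:]:]"
definition var_y :: "complex poly poly poly" where "var_y = [:0, 1:]"

definition g_poly :: "real \<Rightarrow> real \<Rightarrow> real \<Rightarrow> real \<Rightarrow> complex poly poly poly" where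
  "g_poly a b c e = g_form (const3 a) (const3 b) (const3 c) (const3 e) var_x var_y"

definition h_poly :: "real \<Rightarrow> complex poly poly poly" where
  "h_poly f = h_form (const3 f) var_y var_x'"

text \<open>
  The resultant with respect to \<open>y\<^sub>i\<close>. The polynomials are taken with formal degrees 2 and 1
  in \<open>y\<^sub>i\<close>, so that the substitution formula \<open>poly_G_poly\<close> below also holds when \<open>a = c = 0\<close>;
  in all other cases this is the ordinary \<^const>\<open>resultant\<close>, see \<open>G_poly_eq_resultant\<close>.
\<close>

definition G_poly :: "real \<Rightarrow> real \<Rightarrow> real \<Rightarrow> real \<Rightarrow> real \<Rightarrow> complex poly poly" where
  "G_poly a b c e f = resultant_sub 2 1 (g_poly a b c e) (h_poly f)"

lemma g_poly_pCons:
  "g_poly a b c e =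
     [:[:[:complex_of_real e, 0, complex_of_real b:]:],
       [:[:0, 1:]:],
       [:[:complex_of_real c, 0, complex_of_real a:]:]:]"
  by (simp add: g_poly_def g_form_def const3_def var_x_def var_y_def power2_eq_square)

lemma h_poly_pCons:
  "h_poly f =
     [:[:[:- 2 * complex_of_real f:], [:- (1 - (complex_of_real f)^2):]:],
       [:[:1 - (complex_of_real f)^2:], [:- 2 * complex_of_real f:]:]:]"
  by (simp add: h_poly_def h_form_def const3_def var_x'_def var_y_def power2_eq_square
      one_pCons numeral_poly)

lemma resultant_sub_2_1:
  fixes p q :: "'a::comm_ring_1 poly"
  shows "resultant_sub 2 1 p q =
    coeff p 2 * (coeff q 0)^2 - coeff p 1 * coeff q 0 * coeff q 1 + coeff p 0 * (coeff q 1)^2"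
proof -
  have det_2: "det A = A $$ (0,0) * A $$ (1,1) - A $$ (0,1) * A $$ (1,0)"
    if A: "A \<in> carrier_mat 2 2" for A :: "'a mat"
  proof -
    have 1: "det (mat_delete A 0 j) = mat_delete A 0 j $$ (0,0)" if "j < 2" for j
      by (rule det_single) (use A in \<open>auto simp: mat_delete_def\<close>)
    show ?thesis
      using laplace_expansion_row[OF A, of 0] A
      by (simp add: 1 cofactor_def numeral_2_eq_2 mat_delete_def det_single)
  qed
  let ?S = "sylvester_mat_sub 2 1 p q"
  have S: "?S \<in> carrier_mat 3 3"
    using sylvester_mat_sub_carrier[of 2 1 p q] by (simp add: numeral_3_eq_3)
  have "det ?S = ?S $$ (0,0) * cofactor ?S 0 0 + ?S $$ (0,1) * cofactor ?S 0 1
      + ?S $$ (0,2) * cofactor ?S 0 2"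
    using laplace_expansion_row[OF S, of 0] by (simp add: numeral_3_eq_3 numeral_2_eq_2)
  then show ?thesis
    unfolding resultant_sub_def cofactor_def
    by (simp add: det_2[unfolded numeral_2_eq_2] mat_delete_def sylvester_mat_sub_def power2_eq_square algebra_simps)
       (simp add: numeral_2_eq_2)
qed

lemma G_poly_eq_resultant:
  assumes "a \<noteq> 0 \<or> c \<noteq> 0"
  shows "G_poly a b c e f = resultant (g_poly a b c e) (h_poly f)"
proof -
  have "degree (g_poly a b c e) = 2"
    using assms by (auto simp: g_poly_pCons)
  moreover have "f \<noteq> 0 \<or> 1 - (complex_of_real f)^2 \<noteq> 0"
    by auto
  then have "degree (h_poly f) = 1"
    by (auto simp: h_poly_pCons)
  ultimately show ?thesis
    by (simp add: G_poly_def resultant_sub)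
qed

lemma G_poly_expand:
  "G_poly a b c e f =
    (let F = complex_of_real f;
         u = [:[:1 - F^2:], [:- 2 * F:]:];
         v = [:[:2 * F:], [:1 - F^2:]:]
     in [:[:complex_of_real c, 0, complex_of_real a:]:] * v^2 + [:[:0, 1:]:] * v * u
        + [:[:complex_of_real e, 0, complex_of_real b:]:] * u^2)"
proof -
  define F where "F = complex_of_real f"
  define u v where "u = [:[:1 - F^2:], [:- 2 * F:]:]" and "v = [:[:2 * F:], [:1 - F^2:]:]"
  have "h_poly f = [:- v, u:]"
    by (simp add: h_poly_pCons F_def u_def v_def)
  then have "G_poly a b c e f =
      [:[:complex_of_real c, 0, complex_of_real a:]:] * v^2 + [:[:0, 1:]:] * v * u
      + [:[:complex_of_real e, 0, complex_of_real b:]:] * u^2"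
    unfolding G_poly_def resultant_sub_2_1 g_poly_pCons
    by (simp only: coeff_pCons_0 coeff_pCons_Suc numeral_2_eq_2 One_nat_def) simp
  then show ?thesis
    by (simp only: Let_def F_def u_def v_def)
qed

lemma poly_G_poly:
  assumes "1 - (complex_of_real f)^2 - 2 * complex_of_real f * x' \<noteq> 0"
  shows "poly (poly (G_poly a b c e f) [:x':]) x =
    (1 - (complex_of_real f)^2 - 2 * complex_of_real f * x')^2 *
      g_form (complex_of_real a) (complex_of_real b) (complex_of_real c) (complex_of_real e) x
        (((1 - (complex_of_real f)^2) * x' + 2 * complex_of_real f) /
          (1 - (complex_of_real f)^2 - 2 * complex_of_real f * x'))"
proof -
  have aux: "A * v^2 + x * v * u + B * u^2 = u^2 * (A * (v / u)^2 + x * (v / u) + B)"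
    if "u \<noteq> 0" for A B u v :: complex
    using that by (simp add: field_simps power2_eq_square)
  have "poly (poly (G_poly a b c e f) [:x':]) x =
      (a * x^2 + c) * ((1 - (complex_of_real f)^2) * x' + 2 * complex_of_real f)^2
      + x * ((1 - (complex_of_real f)^2) * x' + 2 * complex_of_real f)
          * (1 - (complex_of_real f)^2 - 2 * complex_of_real f * x')
      + (b * x^2 + e) * (1 - (complex_of_real f)^2 - 2 * complex_of_real f * x')^2"
    by (simp add: G_poly_expand Let_def power2_eq_square algebra_simps)
  also have "\<dots> = (1 - (complex_of_real f)^2 - 2 * complex_of_real f * x')^2 *
      g_form (complex_of_real a) (complex_of_real b) (complex_of_real c) (complex_of_real e) x
        (((1 - (complex_of_real f)^2) * x' + 2 * complex_of_real f) /
          (1 - (complex_of_real f)^2 - 2 * complex_of_real f * x'))"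
    by (subst aux[OF assms]) (simp add: g_form_def algebra_simps)
  finally show ?thesis .
qed

lemma degree_G_poly:
  "degree (G_poly a b c e f) \<le> 2"  "degree (coeff (G_poly a b c e f) k) \<le> 2"
  by (auto simp: G_poly_expand Let_def power2_eq_square coeff_pCons split: nat.split)

text \<open>The complex projective line, as nonzero vectors of \<open>\<complex>\<^sup>2\<close> up to scaling.\<close>

definition proj_rel :: "complex \<times> complex \<Rightarrow> complex \<times> complex \<Rightarrow> bool" where
  "proj_rel p q \<longleftrightarrow>
     p \<noteq> (0, 0) \<and> q \<noteq> (0, 0) \<and> (\<exists>r. r \<noteq> 0 \<and> q = (r * fst p, r * snd p))"

lemma part_equivp_proj_rel: "part_equivp proj_rel"
proof (rule part_equivpI)
  show "\<exists>p. proj_rel p p"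
    by (rule exI[of _ "(1, 0)"]) (auto simp: proj_rel_def intro: exI[of _ 1])
  show "symp proj_rel"
  proof (rule sympI)
    fix p q assume "proj_rel p q"
    then obtain r where "p \<noteq> (0, 0)" "q \<noteq> (0, 0)" "r \<noteq> 0" "q = (r * fst p, r * snd p)"
      unfolding proj_rel_def by blast
    then show "proj_rel q p"
      unfolding proj_rel_def by (auto simp: prod_eq_iff intro!: exI[of _ "inverse r"])
  qed
  show "transp proj_rel"
  proof (rule transpI)
    fix p q s assume "proj_rel p q" "proj_rel q s"
    then obtain r r' where "p \<noteq> (0, 0)" "s \<noteq> (0, 0)" "r \<noteq> 0" "r' \<noteq> 0"
      "q = (r * fst p, r * snd p)" "s = (r' * fst q, r' * snd q)"
      unfolding proj_rel_def by blast
    then show "proj_rel p s"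
      unfolding proj_rel_def by (intro conjI exI[of _ "r' * r"]) (auto simp: mult.assoc)
  qed
qed

quotient_type cp1 = "complex \<times> complex" / partial: proj_rel
  by (rule part_equivp_proj_rel)

text \<open>
  Homogenization to bidegree \<open>(2,2)\<close>, evaluated at homogeneous coordinates \<open>[x : w]\<close> and
  \<open>[x' : w']\<close>; the point \<open>\<infinity>\<close> is \<open>[1 : 0]\<close>. As in \<^const>\<open>G_poly\<close>, the inner variable
  belongs to \<open>[x : w]\<close>.
\<close>

definition bihom22 :: "complex poly poly \<Rightarrow> complex \<times> complex \<Rightarrow> complex \<times> complex \<Rightarrow> complex" where
  "bihom22 P p q = (\<Sum>j\<le>2. \<Sum>k\<le>2.
     coeff (coeff P k) j * fst p ^ j * snd p ^ (2 - j) * fst q ^ k * snd q ^ (2 - k))"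

lemma bihom22_scale:
  "bihom22 P (r * fst p, r * snd p) (s * fst q, s * snd q) = r^2 * s^2 * bihom22 P p q"
  by (simp add: bihom22_def numeral_2_eq_2 algebra_simps)

lift_definition vanishes_at :: "complex poly poly \<Rightarrow> cp1 \<Rightarrow> cp1 \<Rightarrow> bool"
  is "\<lambda>P p q. bihom22 P p q = 0"
proof -
  fix P p p' q q' assume "proj_rel p p'" "proj_rel q q'"
  then obtain r s where "r \<noteq> 0" "p' = (r * fst p, r * snd p)"
    "s \<noteq> 0" "q' = (s * fst q, s * snd q)"
    unfolding proj_rel_def by blast
  then show "(bihom22 P p q = 0) = (bihom22 P p' q' = 0)"
    by (simp only: bihom22_scale) simp
qed

definition zero_set ::
  "(4 \<Rightarrow> real) \<Rightarrow> (4 \<Rightarrow> real) \<Rightarrow> (4 \<Rightarrow> real) \<Rightarrow> (4 \<Rightarrow> real) \<Rightarrow> (4 \<Rightarrow> real) \<Rightarrow> (4 \<Rightarrow> cp1) set" where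
  "zero_set a b c e f =
     {x. \<forall>i. vanishes_at (G_poly (a i) (b i) (c i) (e i) (f i)) (x i) (x (i + 1))}"

definition matching ::
  "(4 \<Rightarrow> real) \<Rightarrow> (4 \<Rightarrow> real) \<Rightarrow> (4 \<Rightarrow> real) \<Rightarrow> (4 \<Rightarrow> real) \<Rightarrow> (4 \<Rightarrow> real) \<Rightarrow> bool" where
  "matching a b c e f \<longleftrightarrow> infinite (zero_set a b c e f)"

definition k_val :: "real \<Rightarrow> real \<Rightarrow> real \<Rightarrow> real" where
  "k_val s a e = (- 1 + s * sqrt (1 - 4*a*e)) / (2*a)"

definition N_mat :: "real \<Rightarrow> real \<Rightarrow> real mat" where
  "N_mat k f = mat_of_rows_list 2
     [[- 2*f,   k * (1 - f\<^sup>2)],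
      [1 - f\<^sup>2, 2*k*f        ]]"

definition scalar_matrix :: "nat \<Rightarrow> 'a::comm_ring_1 mat \<Rightarrow> bool" where
  "scalar_matrix n A \<longleftrightarrow> (\<exists>r. A = r \<cdot>\<^sub>m 1\<^sub>m n)"

end

theory Submission
  imports Defs "HOL-Analysis.Cartesian_Space"
begin

text \<open>
  When \<open>b = c = 0\<close>, the form \<open>g = a x\<^sup>2 y\<^sup>2 + x y + e\<close> is a quadratic polynomial in the
  single product \<open>x y\<close>, and its roots are the two values of \<open>k\<close>. These are real because the
  standing inequalities force \<open>4 a e < 1\<close>, and nonzero because \<open>e \<noteq> 0\<close>. So
  \<open>g = a (x y - k\<^sub>1) (x y - k\<^sub>2)\<close>. As \<open>h = 0\<close> makes \<open>y\<close> a Moebius function of \<open>x'\<close>, a factor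
  \<open>x y - k\<close> vanishes exactly when \<open>x'\<close> is the image of \<open>x\<close> under the projective
  transformation with matrix \<open>N\<close>, which is invertible since
  \<open>det N = - k (1 + f\<^sup>2)\<^sup>2\<close>. Hence \<open>G\<close> vanishes at \<open>(x, x')\<close> if and only if \<open>x' = N x\<close> for one
  of the two signs (\<open>vanishes_at_iff_projectivity\<close>).

  The zero set is therefore a union, over the sixteen choices of signs, of the sets of closed
  4-cycles \<open>x\<^sub>i\<^sub>+\<^sub>1 = N\<^sub>i x\<^sub>i\<close>. Such a cycle is determined by \<open>x\<^sub>1\<close>, which can be any fixed point
  of \<open>N\<^sub>4 N\<^sub>3 N\<^sub>2 N\<^sub>1\<close> (\<open>infinite_cycles_iff\<close>). Finally, the fixed points of a
  projective transformation of the line are the zeros of a binary quadratic form, so there are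
  infinitely many of them only if this form is identically zero, that is, if the
  matrix is scalar (\<open>infinite_fixed_points_iff\<close>).
\<close>

section \<open>Points of the complex projective line\<close>

lemma proj_rel_iff_cross:
  "proj_rel p q \<longleftrightarrow> p \<noteq> (0, 0) \<and> q \<noteq> (0, 0) \<and> fst p * snd q = snd p * fst q"
proof
  assume R: "p \<noteq> (0, 0) \<and> q \<noteq> (0, 0) \<and> fst p * snd q = snd p * fst q"
  show "proj_rel p q"
  proof (cases "fst p = 0")
    case True
    with R have "snd p \<noteq> 0" "fst q = 0" "snd q \<noteq> 0"
      by (auto simp: prod_eq_iff)
    with R True show ?thesis
      by (auto simp: proj_rel_def prod_eq_iff intro!: exI[of _ "snd q / snd p"])
  next
    case False
    with R have "fst q \<noteq> 0"
      by (auto simp: prod_eq_iff)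
    with R False show ?thesis
      by (auto simp: proj_rel_def prod_eq_iff field_simps intro!: exI[of _ "fst q / fst p"])
  qed
qed (auto simp: proj_rel_def)

lemma abs_cp1_eq_iff:
  assumes "p \<noteq> (0, 0)" "q \<noteq> (0, 0)"
  shows "abs_cp1 p = abs_cp1 q \<longleftrightarrow> fst p * snd q = snd p * fst q"
proof -
  have "proj_rel p p" "proj_rel q q"
    using assms by (auto simp: proj_rel_iff_cross)
  then have "abs_cp1 p = abs_cp1 q \<longleftrightarrow> proj_rel p q"
    using Quotient3_rel[OF Quotient3_cp1, of p q] by auto
  then show ?thesis
    using assms by (simp add: proj_rel_iff_cross)
qed

lemma abs_rep_cp1: "abs_cp1 (rep_cp1 X) = X"
  by (rule Quotient3_abs_rep[OF Quotient3_cp1])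

lemma rep_cp1_nonzero: "rep_cp1 X \<noteq> (0, 0)"
  using Quotient3_rep_reflp[OF Quotient3_cp1, of X] by (simp add: proj_rel_def)

lemma vanishes_at_abs_cp1:
  assumes "p \<noteq> (0, 0)" "q \<noteq> (0, 0)"
  shows "vanishes_at P (abs_cp1 p) (abs_cp1 q) \<longleftrightarrow> bihom22 P p q = 0"
  by (rule vanishes_at.abs_eq) (use assms in \<open>auto simp: proj_rel_iff_cross\<close>)

lemma infinite_UNIV_cp1: "infinite (UNIV :: cp1 set)"
proof
  assume "finite (UNIV :: cp1 set)"
  then have "finite (range (\<lambda>z. abs_cp1 (z, 1)))"
    by (rule finite_subset[rotated]) simp
  moreover have "inj (\<lambda>z. abs_cp1 (z, 1))"
    by (auto simp: inj_on_def abs_cp1_eq_iff)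
  ultimately have "finite (UNIV :: complex set)"
    by (rule finite_imageD)
  then show False
    using infinite_UNIV_char_0 by blast
qed

section \<open>Projective transformations and their fixed points\<close>

definition mat2_apply :: "real mat \<Rightarrow> complex \<times> complex \<Rightarrow> complex \<times> complex" where
  "mat2_apply A p =
     (of_real (A $$ (0,0)) * fst p + of_real (A $$ (0,1)) * snd p,
      of_real (A $$ (1,0)) * fst p + of_real (A $$ (1,1)) * snd p)"

definition nonsingular2 :: "real mat \<Rightarrow> bool" where
  "nonsingular2 A \<longleftrightarrow> A \<in> carrier_mat 2 2 \<and> (\<forall>p. mat2_apply A p = (0, 0) \<longrightarrow> p = (0, 0))"

text \<open>
  Only for a nonsingular matrix is this the induced map of the projective line: otherwise
  the chosen representative may be sent to the origin, which represents no point.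
\<close>

definition projectivity :: "real mat \<Rightarrow> cp1 \<Rightarrow> cp1" where
  "projectivity A X = abs_cp1 (mat2_apply A (rep_cp1 X))"

lemma nonsingular2D:
  assumes "nonsingular2 A"
  shows "A \<in> carrier_mat 2 2" "p \<noteq> (0, 0) \<Longrightarrow> mat2_apply A p \<noteq> (0, 0)"
  using assms unfolding nonsingular2_def by blast+

lemma mat2_apply_mult:
  assumes "A \<in> carrier_mat 2 2" "B \<in> carrier_mat 2 2"
  shows "mat2_apply (A * B) p = mat2_apply A (mat2_apply B p)"
  using assms
  by (auto simp: mat2_apply_def times_mat_def scalar_prod_def numeral_2_eq_2 algebra_simps)

lemma nonsingular2_mult:
  assumes "nonsingular2 A" "nonsingular2 B"
  shows "nonsingular2 (A * B)"
proof -
  have "p = (0, 0)" if "mat2_apply (A * B) p = (0, 0)" for p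
    using that nonsingular2D(2)[OF assms(1)] nonsingular2D(2)[OF assms(2)]
    unfolding mat2_apply_mult[OF nonsingular2D(1)[OF assms(1)] nonsingular2D(1)[OF assms(2)]]
    by blast
  then show ?thesis
    unfolding nonsingular2_def using mult_carrier_mat nonsingular2D(1)[OF assms(1)] nonsingular2D(1)[OF assms(2)]
    by blast
qed

lemma projectivity_abs_cp1:
  assumes "nonsingular2 A" "p \<noteq> (0, 0)"
  shows "projectivity A (abs_cp1 p) = abs_cp1 (mat2_apply A p)"
proof -
  define q where "q = rep_cp1 (abs_cp1 p)"
  have q: "q \<noteq> (0, 0)"
    by (simp add: q_def rep_cp1_nonzero)
  have "abs_cp1 p = abs_cp1 q"
    by (simp add: q_def abs_rep_cp1)
  then have "proj_rel p q"
    using assms q by (simp add: abs_cp1_eq_iff proj_rel_iff_cross)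
  then obtain r where "q = (r * fst p, r * snd p)"
    by (auto simp: proj_rel_def)
  then have "fst (mat2_apply A q) = r * fst (mat2_apply A p)"
    "snd (mat2_apply A q) = r * snd (mat2_apply A p)"
    by (simp_all add: mat2_apply_def algebra_simps)
  then show ?thesis
    using nonsingular2D(2)[OF assms(1)] assms(2) q
    by (simp add: projectivity_def abs_cp1_eq_iff flip: q_def)
qed

lemma projectivity_mult:
  assumes "nonsingular2 A" "nonsingular2 B"
  shows "projectivity (A * B) X = projectivity A (projectivity B X)"
proof -
  have "projectivity A (projectivity B X) = abs_cp1 (mat2_apply A (mat2_apply B (rep_cp1 X)))"
    using assms
    by (simp add: projectivity_def[of B] projectivity_abs_cp1 nonsingular2D rep_cp1_nonzero)
  then show ?thesis
    using assms by (simp add: projectivity_def[of "A * B"] mat2_apply_mult nonsingular2D)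
qed

lemma scalar_matrix_2_iff:
  assumes "A \<in> carrier_mat 2 2"
  shows "scalar_matrix 2 A \<longleftrightarrow> A $$ (0,1) = 0 \<and> A $$ (1,0) = 0 \<and> A $$ (0,0) = A $$ (1,1)"
proof
  assume R: "A $$ (0,1) = 0 \<and> A $$ (1,0) = 0 \<and> A $$ (0,0) = A $$ (1,1)"
  have "A = A $$ (0,0) \<cdot>\<^sub>m 1\<^sub>m 2"
    by (rule eq_matI) (use R assms in \<open>auto simp: less_2_cases_iff\<close>)
  then show "scalar_matrix 2 A"
    by (auto simp: scalar_matrix_def)
qed (auto simp: scalar_matrix_def)

text \<open>
  In the affine coordinate \<open>z = [z : 1]\<close> the fixed points of a matrix with rows \<open>(A, B)\<close> and
  \<open>(C, D)\<close> are the roots of \<open>C z\<^sup>2 + (D - A) z - B\<close>; this polynomial is nonzero exactly when the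
  matrix is not scalar.
\<close>

lemma infinite_fixed_points_iff:
  assumes A: "nonsingular2 A"
  shows "infinite {X. projectivity A X = X} \<longleftrightarrow> scalar_matrix 2 A"
proof
  assume "scalar_matrix 2 A"
  then have S: "A $$ (0,1) = 0 \<and> A $$ (1,0) = 0 \<and> A $$ (0,0) = A $$ (1,1)"
    using A by (simp add: scalar_matrix_2_iff nonsingular2D)
  have "projectivity A X = X" for X
  proof -
    have "projectivity A X = abs_cp1 (rep_cp1 X)"
      unfolding projectivity_def
      by (subst abs_cp1_eq_iff[OF nonsingular2D(2)[OF A rep_cp1_nonzero] rep_cp1_nonzero])
         (simp add: S[simplified] mat2_apply_def)
    then show ?thesis
      by (simp add: abs_rep_cp1)
  qed
  then show "infinite {X. projectivity A X = X}"
    using infinite_UNIV_cp1 by simp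
next
  assume inf: "infinite {X. projectivity A X = X}"
  define P :: "complex poly" where
    "P = [:- of_real (A $$ (0,1)), of_real (A $$ (1,1) - A $$ (0,0)), of_real (A $$ (1,0)):]"
  have fixed: "X = abs_cp1 (1, 0) \<or> (\<exists>z. poly P z = 0 \<and> X = abs_cp1 (z, 1))"
    if "projectivity A X = X" for X
  proof (cases "snd (rep_cp1 X) = 0")
    case True
    then have "abs_cp1 (rep_cp1 X) = abs_cp1 (1, 0)"
      by (simp add: abs_cp1_eq_iff rep_cp1_nonzero)
    then show ?thesis
      by (simp add: abs_rep_cp1)
  next
    case False
    define z where "z = fst (rep_cp1 X) / snd (rep_cp1 X)"
    have "abs_cp1 (rep_cp1 X) = abs_cp1 (z, 1)"
      using False by (simp add: abs_cp1_eq_iff rep_cp1_nonzero z_def)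
    then have X: "X = abs_cp1 (z, 1)"
      by (simp add: abs_rep_cp1)
    with that A have "abs_cp1 (mat2_apply A (z, 1)) = abs_cp1 (z, 1)"
      by (simp add: projectivity_abs_cp1)
    then have "fst (mat2_apply A (z, 1)) = snd (mat2_apply A (z, 1)) * z"
      using A by (simp add: abs_cp1_eq_iff nonsingular2D)
    then have "poly P z = 0"
      by (simp add: P_def mat2_apply_def algebra_simps)
    with X show ?thesis
      by blast
  qed
  have "P = 0"
  proof (rule ccontr)
    assume "P \<noteq> 0"
    then have "finite (insert (abs_cp1 (1, 0)) ((\<lambda>z. abs_cp1 (z, 1)) ` {z. poly P z = 0}))"
      by (simp add: poly_roots_finite)
    moreover have "{X. projectivity A X = X} \<subseteq> \<dots>"
      using fixed by auto
    ultimately show False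
      using inf finite_subset by blast
  qed
  then show "scalar_matrix 2 A"
    using A by (auto simp: scalar_matrix_2_iff nonsingular2D P_def)
qed

section \<open>Closed cycles of length four\<close>

text \<open>A cycle is recovered from its first point, which the round trip must fix.\<close>

lemma infinite_cycles_iff:
  fixes N :: "4 \<Rightarrow> real mat"
  assumes N: "\<And>i. nonsingular2 (N i)"
  shows "infinite {x. \<forall>i. x (i + 1) = projectivity (N i) (x i)} \<longleftrightarrow>
    scalar_matrix 2 (N 4 * N 3 * N 2 * N 1)"
proof -
  let ?C = "{x. \<forall>i. x (i + 1) = projectivity (N i) (x i)}"
  let ?F = "{X. projectivity (N 4 * N 3 * N 2 * N 1) X = X}"
  have M: "projectivity (N 4 * N 3 * N 2 * N 1) X =
      projectivity (N 4) (projectivity (N 3) (projectivity (N 2) (projectivity (N 1) X)))" for X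
    using N by (simp add: projectivity_mult nonsingular2_mult)
  have C: "x \<in> ?C \<longleftrightarrow> x 2 = projectivity (N 1) (x 1) \<and> x 3 = projectivity (N 2) (x 2) \<and>
      x 4 = projectivity (N 3) (x 3) \<and> x 1 = projectivity (N 4) (x 4)" for x
  proof -
    have "(5 :: 4) = 1"
      by simp
    from arg_cong[OF this, of x] show ?thesis
      by (simp add: forall_4)
  qed
  have inj: "inj_on (\<lambda>x. x 1) ?C"
  proof (rule inj_onI)
    fix x y assume x: "x \<in> ?C" and y: "y \<in> ?C" and 1: "x 1 = y 1"
    have step: "x (i + 1) = y (i + 1)" if "x i = y i" for i
    proof -
      have "x (i + 1) = projectivity (N i) (x i)" "y (i + 1) = projectivity (N i) (y i)"
        using x y by blast+
      then show ?thesis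
        by (simp only: that)
    qed
    have 2: "x 2 = y 2"
      using step[of 1] 1 by simp
    have 3: "x 3 = y 3"
      using step[of 2] 2 by simp
    have 4: "x 4 = y 4"
      using step[of 3] 3 by simp
    show "x = y"
      using 1 2 3 4 by (simp add: fun_eq_iff forall_4)
  qed
  have "(\<lambda>x. x 1) ` ?C = ?F"
  proof (intro equalityI subsetI)
    fix X assume "X \<in> (\<lambda>x. x 1) ` ?C"
    then obtain x where "x \<in> ?C" "X = x 1"
      by blast
    then have "x 2 = projectivity (N 1) X" "x 3 = projectivity (N 2) (x 2)"
      "x 4 = projectivity (N 3) (x 3)" "X = projectivity (N 4) (x 4)"
      unfolding C by blast+
    then have "projectivity (N 4 * N 3 * N 2 * N 1) X = X"
      unfolding M by metis
    then show "X \<in> ?F"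
      by blast
  next
    fix X assume X: "X \<in> ?F"
    define X2 where "X2 = projectivity (N 1) X"
    define X3 where "X3 = projectivity (N 2) X2"
    define X4 where "X4 = projectivity (N 3) X3"
    define x :: "4 \<Rightarrow> cp1" where
      "x = (\<lambda>i. if i = 1 then X else if i = 2 then X2 else if i = 3 then X3 else X4)"
    have x: "x 1 = X" "x 2 = X2" "x 3 = X3" "x 4 = X4"
      by (simp_all add: x_def)
    have "x \<in> ?C"
      unfolding C x using X by (simp add: M X2_def X3_def X4_def)
    then show "X \<in> (\<lambda>x. x 1) ` ?C"
      using x(1) by force
  qed
  then have "finite ?C \<longleftrightarrow> finite ?F"
    using finite_image_iff[OF inj] by simp
  then show ?thesis
    using infinite_fixed_points_iff[of "N 4 * N 3 * N 2 * N 1"] N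
    by (simp add: nonsingular2_mult)
qed

section \<open>Factorization of the resultant\<close>

text \<open>
  The bound \<open>\<bar>a + e\<bar> < 1\<close> gives \<open>4 a e \<le> (a + e)\<^sup>2 < 1\<close>.
\<close>

lemma standing_ineqs_discriminant_pos:
  assumes "standing_ineqs a 0 0 e"
  shows "4 * a * e < 1"
proof -
  have "\<bar>a + e\<bar> < 1"
    using assms by (simp add: standing_ineqs_def abs_if split: if_splits)
  then have "(a + e)\<^sup>2 < 1"
    by (simp add: abs_square_less_1)
  moreover have "4 * a * e \<le> (a + e)\<^sup>2"
    using zero_le_power2[of "a - e"] by (simp add: power2_eq_square algebra_simps)
  ultimately show ?thesis
    by linarith
qed

lemma k_val_vieta:
  assumes "a \<noteq> 0" "4 * a * e < 1"
  shows "a * (k_val 1 a e + k_val (- 1) a e) = - 1" "a * k_val 1 a e * k_val (- 1) a e = e"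
proof -
  have "sqrt (1 - 4*a*e) * sqrt (1 - 4*a*e) = 1 - 4*a*e"
    using assms by simp
  then show "a * (k_val 1 a e + k_val (- 1) a e) = - 1" "a * k_val 1 a e * k_val (- 1) a e = e"
    using assms by (simp_all add: k_val_def field_simps)
qed

lemma k_val_nonzero:
  assumes "a \<noteq> 0" "e \<noteq> 0" "4 * a * e < 1" "s \<in> {1, - 1}"
  shows "k_val s a e \<noteq> 0"
  using k_val_vieta(2)[OF assms(1,3)] assms by auto

lemma mat2_apply_N_mat:
  "mat2_apply (N_mat k f) (x, w) =
    (- 2 * of_real f * x + of_real k * (1 - (of_real f)\<^sup>2) * w,
     (1 - (of_real f)\<^sup>2) * x + 2 * of_real k * of_real f * w)"
  by (simp add: mat2_apply_def N_mat_def mat_of_rows_list_def)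

text \<open>
  With \<open>u = 1 - f\<^sup>2\<close> and \<open>v = 2 f\<close>, the determinant is
  \<open>- k (u\<^sup>2 + v\<^sup>2) = - k (1 + f\<^sup>2)\<^sup>2\<close>. The kernel is shown to be trivial by
  Cramer's rule, with the common factor \<open>k\<close> cancelled in the equation for \<open>x\<close>.
\<close>

lemma nonsingular2_N_mat:
  assumes "k \<noteq> 0"
  shows "nonsingular2 (N_mat k f)"
proof -
  have "x = 0 \<and> w = 0" if "mat2_apply (N_mat k f) (x, w) = (0, 0)" for x w :: complex
  proof -
    define u v where "u = 1 - (complex_of_real f)\<^sup>2" and "v = 2 * complex_of_real f"
    have 1: "- v * x + k * u * w = 0" "u * x + k * v * w = 0"
      using that by (simp_all add: mat2_apply_N_mat u_def v_def mult.assoc mult.left_commute)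
    have "(u * u + v * v) * x = u * (u * x + k * v * w) - v * (- v * x + k * u * w)"
      "k * (u * u + v * v) * w = u * (- v * x + k * u * w) + v * (u * x + k * v * w)"
      by (simp_all add: algebra_simps)
    with 1 have 2: "(u * u + v * v) * x = 0" "k * (u * u + v * v) * w = 0"
      by simp_all
    have "u * u + v * v = complex_of_real ((1 + f\<^sup>2)\<^sup>2)"
      by (simp add: u_def v_def power2_eq_square algebra_simps)
    moreover have "1 + f\<^sup>2 \<noteq> 0"
      using zero_le_power2[of f] by linarith
    ultimately have "u * u + v * v \<noteq> 0"
      by (metis of_real_eq_0_iff power_eq_0_iff)
    with 2 assms show ?thesis
      by simp
  qed
  then show ?thesis
    by (auto simp: nonsingular2_def N_mat_def mat_of_rows_list_def)
qed

text \<open>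
  The point \<open>[v : u]\<close> is the solution \<open>y\<close> of \<open>h = 0\<close> in homogeneous coordinates, so the right-hand
  side is \<open>g\<close> homogenized in both variables and evaluated there. Unlike the substitution formula
  \<open>poly_G_poly\<close>, this covers the points at infinity and the zeros of \<open>u\<close>.
\<close>

lemma bihom22_G_poly:
  fixes f :: real and x w x' w' :: complex
  defines "u \<equiv> (1 - (of_real f)\<^sup>2) * w' - 2 * of_real f * x'"
    and "v \<equiv> (1 - (of_real f)\<^sup>2) * x' + 2 * of_real f * w'"
  shows "bihom22 (G_poly a 0 0 e f) (x, w) (x', w') =
    of_real a * x\<^sup>2 * v\<^sup>2 + x * w * v * u + of_real e * w\<^sup>2 * u\<^sup>2"
proof -
  define F :: complex where "F = of_real f"
  define t where "t = 1 - F\<^sup>2"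
  have "G_poly a 0 0 e f =
      [:[:of_real e * t\<^sup>2, 2 * F * t, 4 * F\<^sup>2 * of_real a:],
        [:- 4 * F * t * of_real e, t\<^sup>2 - 4 * F\<^sup>2, 4 * F * t * of_real a:],
        [:4 * F\<^sup>2 * of_real e, - 2 * F * t, t\<^sup>2 * of_real a:]:]"
    unfolding G_poly_expand Let_def F_def[symmetric] t_def[symmetric]
    by (simp add: power2_eq_square algebra_simps)
  then show ?thesis
    unfolding u_def v_def F_def[symmetric] t_def[symmetric]
    by (simp add: bihom22_def numeral_2_eq_2 algebra_simps)
qed

text \<open>
  Vieta's formulas split the binary quadratic form \<open>a X\<^sup>2 + X Y + e Y\<^sup>2\<close>, \<open>X = x v\<close>, \<open>Y = w u\<close>, into
  \<open>a (X - k\<^sub>1 Y) (X - k\<^sub>2 Y)\<close>, and \<open>X - k Y\<close> is the cross product of \<open>(x', w')\<close> with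
  \<open>N (x, w)\<close>, whose vanishing says that the two vectors span the same line.
\<close>

lemma vanishes_at_iff_projectivity:
  assumes "a \<noteq> 0" "e \<noteq> 0" "4 * a * e < 1"
  shows "vanishes_at (G_poly a 0 0 e f) X X' \<longleftrightarrow>
    (\<exists>s\<in>{1, - 1}. X' = projectivity (N_mat (k_val s a e) f) X)"
proof -
  obtain x w x' w' where rep: "rep_cp1 X = (x, w)" "rep_cp1 X' = (x', w')"
    by (metis surj_pair)
  have nz: "(x, w) \<noteq> (0, 0)" "(x', w') \<noteq> (0, 0)"
    using rep_cp1_nonzero rep by metis+
  have X: "X = abs_cp1 (x, w)" "X' = abs_cp1 (x', w')"
    using abs_rep_cp1 rep by metis+
  define u v where "u = (1 - (complex_of_real f)\<^sup>2) * w' - 2 * of_real f * x'"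
    and "v = (1 - (complex_of_real f)\<^sup>2) * x' + 2 * of_real f * w'"
  define k k' where "k = complex_of_real (k_val 1 a e)" and "k' = complex_of_real (k_val (- 1) a e)"
  have vieta: "of_real a * (k + k') = - 1" "of_real a * k * k' = of_real e"
    using k_val_vieta[OF assms(1,3)] unfolding k_def k'_def
    by (metis of_real_add of_real_mult of_real_minus of_real_1)+
  have root: "X' = projectivity (N_mat (k_val s a e) f) X \<longleftrightarrow>
      x * v - of_real (k_val s a e) * w * u = 0" if "s \<in> {1, - 1}" for s
  proof -
    have N: "nonsingular2 (N_mat (k_val s a e) f)"
      using k_val_nonzero[OF assms that] by (rule nonsingular2_N_mat)
    show ?thesis
      unfolding X using nz N
      by (simp add: projectivity_abs_cp1 nonsingular2D abs_cp1_eq_iff)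
         (simp add: mat2_apply_N_mat u_def v_def algebra_simps)
  qed
  have "of_real a * x\<^sup>2 * v\<^sup>2 + x * w * v * u + of_real e * w\<^sup>2 * u\<^sup>2 =
      of_real a * x\<^sup>2 * v\<^sup>2 - (of_real a * (k + k')) * x * w * v * u
        + of_real a * k * k' * w\<^sup>2 * u\<^sup>2"
    unfolding vieta by simp
  also have "\<dots> = of_real a * (x * v - k * w * u) * (x * v - k' * w * u)"
    by (simp add: power2_eq_square algebra_simps)
  finally have "vanishes_at (G_poly a 0 0 e f) X X' \<longleftrightarrow>
      of_real a * (x * v - k * w * u) * (x * v - k' * w * u) = 0"
    unfolding X vanishes_at_abs_cp1[OF nz] bihom22_G_poly u_def v_def by simp
  then show ?thesis
    using assms(1) root[of 1] root[of "- 1"] by (simp add: k_def k'_def)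
qed

section \<open>The criterion\<close>

theorem theorem5p1:
  fixes a b c e f :: "4 \<Rightarrow> real"
  assumes "\<And>i. a i \<noteq> 0"
    and "\<And>i. e i \<noteq> 0"
    and "\<And>i. b i = 0"
    and "\<And>i. c i = 0"
    and "\<And>i. f i \<in> {-1<..1}"
    and "\<And>i. standing_ineqs (a i) (b i) (c i) (e i)"
  shows "matching a b c e f \<longleftrightarrow>
    (\<exists>s :: 4 \<Rightarrow> real. (\<forall>i. s i \<in> {1, -1}) \<and>
      (let N = (\<lambda>i. N_mat (k_val (s i) (a i) (e i)) (f i))
       in scalar_matrix 2 (N 4 * N 3 * N 2 * N 1)))"
proof -
  define N where "N s i = N_mat (k_val (s i) (a i) (e i)) (f i)" for s :: "4 \<Rightarrow> real" and i
  define S :: "(4 \<Rightarrow> real) set" where "S = {s. \<forall>i. s i \<in> {1, -1}}"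
  define C where "C s = {x. \<forall>i. x (i + 1) = projectivity (N s i) (x i)}" for s
  have disc: "4 * a i * e i < 1" for i
    using assms(3,4,6)[of i] by (simp add: standing_ineqs_discriminant_pos)
  have N: "nonsingular2 (N s i)" if "s \<in> S" for s i
    unfolding N_def using that assms(1,2) disc
    by (intro nonsingular2_N_mat k_val_nonzero) (auto simp: S_def)
  have "zero_set a b c e f =
      {x. \<forall>i. \<exists>t\<in>{1, -1}. x (i + 1) = projectivity (N_mat (k_val t (a i) (e i)) (f i)) (x i)}"
    unfolding zero_set_def
    by (simp only: assms(3,4) vanishes_at_iff_projectivity[OF assms(1,2) disc])
  also have "\<dots> = (\<Union>s\<in>S. C s)"
    by (auto simp only: Bex_def choice_iff all_conj_distrib S_def C_def N_def)
  finally have Z: "zero_set a b c e f = (\<Union>s\<in>S. C s)" .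
  have "S = (\<Pi>\<^sub>E i\<in>UNIV. {1, - 1})"
    by (auto simp: S_def PiE_UNIV_domain)
  \<comment> \<open>Finitely many choices of signs, so the union is infinite only if one of its parts is.\<close>
  then have "finite S"
    by (simp add: finite_PiE)
  then have "matching a b c e f \<longleftrightarrow> (\<exists>s\<in>S. infinite (C s))"
    unfolding matching_def Z by simp
  also have "\<dots> \<longleftrightarrow> (\<exists>s\<in>S. scalar_matrix 2 (N s 4 * N s 3 * N s 2 * N s 1))"
    unfolding C_def using infinite_cycles_iff[OF N] by auto
  finally show ?thesis
    by (simp add: S_def N_def Bex_def Let_def)
qed

end
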